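(* Let $X$ be a real reflexive Banach space with dual space $X^*$, let $n\in\{2,3,\dots\}$, and let $S:X\rightrightarrows X^*$ be an $n$-monotone set-valued operator with $G(S)\neq\emptyset$. Suppose that $\langle x^*,x\rangle\le F_{S,n}^*(x^*,x)$ for all $(x^*,x)\in X^*\times X$. Let $B:X\to X^*$ be a linear, continuous, monotone and coercive operator. Then for every $w^*\in X^*$ satisfying $$(0,w^* )\in\operatorname{dom}\big(F_{S,n}^{*\top}\big)-G(B^* )$$ there exists $x\in\operatorname{cl}\operatorname{co}D(S)$ such that $\{(x,w^*-Bx)\}\cup G(S)$ is $n$-monotone.
   Context: $\langle x^*,x\rangle$ denotes the value of $x^*\in X^*$ at $x\in X$; $\overline{\mathbb{R}}=\mathbb{R}\cup\{\pm\infty\}$; $\operatorname{cl}$ and $\operatorname{co}$ denote (norm) closure and convex hull; $\operatorname{dom}f=\{z:f(z)<+\infty\}$ for an $\overline{\mathbb{R}}$-valued function $f$; $C-D=\{c-d:c\in C,d\in D\}$ for sets $C,D$. For a set-valued operator $S:X\rightrightarrows X^*$, the graph is $G(S)=\{(x,x^* )\in X\times X^*: x^*\in S(x)\}$ and the domain is $D(S)=\{x\in X:S(x)\neq\emptyset\}$. For an integer $n\ge 2$, $S$ is $n$-monotone (also called $n$-cyclically monotone) if $\sum_{i=1}^n\langle s_i^*,s_{i+1}-s_i\rangle\le 0$ for all $(s_1,s_1^* ),\dots,(s_n,s_n^* )\in G(S)$, where $s_{n+1}=s_1$. A subset of $X\times X^*$ is called $n$-monotone if the operator having it as its graph is $n$-monotone.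 Monotone means $2$-monotone; for a linear operator $B:X\to X^*$ this means $\langle Bx,x\rangle\ge 0$ for all $x\in X$. The Fitzpatrick function of order $n$ of $S$ is $F_{S,n}:X\times X^*\to\overline{\mathbb{R}}$, $$F_{S,n}(x,x^* )=\sup\Big\{\sum_{i=1}^{n-2}\langle s_i^*,s_{i+1}-s_i\rangle+\langle s_{n-1}^*,x-s_{n-1}\rangle+\langle x^*,s_1\rangle : (s_i,s_i^* )\in G(S),\ i=1,\dots,n-1\Big\}$$ (for $n=2$ the sum over $i$ is empty). Identifying $X^{**}$ with $X$ by reflexivity, its Fenchel conjugate is $F_{S,n}^*:X^*\times X\to\overline{\mathbb{R}}$, $F_{S,n}^*(x^*,x)=\sup_{(y,y^* )\in X\times X^*}\{\langle x^*,y\rangle+\langle y^*,x\rangle-F_{S,n}(y,y^* )\}$, and its transpose is $F_{S,n}^{*\top}:X\times X^*\to\overline{\mathbb{R}}$, $F_{S,n}^{*\top}(x,x^* )=F_{S,n}^*(x^*,x)$. A linear continuous operator $B:X\to X^*$ is coercive if $\lim_{\|x\|\to+\infty}\langle Bx,x\rangle=+\infty$. Its adjoint is regarded, by reflexivity, as the operator $B^*:X\to X^*$ given by $\langle B^*x,y\rangle=\langle By,x\rangle$ for all $x,y\in X$, and $G(B^* )=\{(x,B^*x):x\in X\}$. *)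

theory Defs
  imports "HOL-Analysis.Analysis"
begin

text \<open>The dual of a real normed space \<open>'a\<close> is the type \<open>'a \<Rightarrow>\<^sub>L real\<close>; the value of a functional at a
  point is given by \<^const>\<open>blinfun_apply\<close>.\<close>

type_synonym 'a dual = "'a \<Rightarrow>\<^sub>L real"

text \<open>Surjectivity of the canonical embedding into the bidual.\<close>

definition reflexive_space :: "'a::real_normed_vector itself \<Rightarrow> bool" where
  "reflexive_space _ \<longleftrightarrow>
     (\<forall>\<Phi> :: 'a dual dual. \<exists>x :: 'a. \<forall>f :: 'a dual. blinfun_apply \<Phi> f = blinfun_apply f x)"

definition op_graph :: "('a::real_normed_vector \<Rightarrow> 'a dual set) \<Rightarrow> ('a \<times> 'a dual) set" where
  "op_graph S = {(x, x'). x' \<in> S x}"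

definition op_domain :: "('a::real_normed_vector \<Rightarrow> 'a dual set) \<Rightarrow> 'a set" where
  "op_domain S = {x. S x \<noteq> {}}"

definition n_monotone_set :: "nat \<Rightarrow> ('a::real_normed_vector \<times> 'a dual) set \<Rightarrow> bool" where
  "n_monotone_set n A \<longleftrightarrow>
     (\<forall>(s :: nat \<Rightarrow> 'a) (s' :: nat \<Rightarrow> 'a dual).
        (\<forall>i\<in>{1..n}. (s i, s' i) \<in> A) \<and> s (n + 1) = s 1 \<longrightarrow>
        (\<Sum>i = 1..n. blinfun_apply (s' i) (s (i + 1) - s i)) \<le> 0)"

definition n_monotone :: "nat \<Rightarrow> ('a::real_normed_vector \<Rightarrow> 'a dual set) \<Rightarrow> bool" where
  "n_monotone n S \<longleftrightarrow> n_monotone_set n (op_graph S)"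

definition fitzpatrick ::
    "('a::real_normed_vector \<Rightarrow> 'a dual set) \<Rightarrow> nat \<Rightarrow> 'a \<times> 'a dual \<Rightarrow> ereal" where
  "fitzpatrick S n = (\<lambda>(x, x').
     Sup {ereal ((\<Sum>i = 1..n - 2. blinfun_apply (s' i) (s (i + 1) - s i))
                 + blinfun_apply (s' (n - 1)) (x - s (n - 1)) + blinfun_apply x' (s 1)) |
          (s :: nat \<Rightarrow> 'a) (s' :: nat \<Rightarrow> 'a dual).
          \<forall>i\<in>{1..n - 1}. (s i, s' i) \<in> op_graph S})"

text \<open>Fenchel conjugate of a function on \<open>X \<times> X\<^sup>*\<close>, as a function on \<open>X\<^sup>* \<times> X\<close>: the bidual is
  identified with \<open>X\<close>, which is meaningful for reflexive \<open>X\<close>. The first summand is always finite,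
  so no indeterminate difference of infinities occurs.\<close>

definition fenchel_conjugate ::
    "('a::real_normed_vector \<times> 'a dual \<Rightarrow> ereal) \<Rightarrow> 'a dual \<times> 'a \<Rightarrow> ereal" where
  "fenchel_conjugate f = (\<lambda>(x', x).
     SUP (y, y')\<in>UNIV. ereal (blinfun_apply x' y + blinfun_apply y' x) - f (y, y'))"

definition transpose_fun :: "('b \<times> 'a \<Rightarrow> ereal) \<Rightarrow> 'a \<times> 'b \<Rightarrow> ereal" where
  "transpose_fun f = (\<lambda>(x, y). f (y, x))"

definition effective_domain :: "('c \<Rightarrow> ereal) \<Rightarrow> 'c set" where
  "effective_domain f = {z. f z < \<infinity>}"

text \<open>On sets, the operator \<open>-\<close> is the set-theoretic difference, hence a separate constant.\<close>

definition minkowski_diff :: "'c::minus set \<Rightarrow> 'c set \<Rightarrow> 'c set" where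
  "minkowski_diff C D = {c - d | c d. c \<in> C \<and> d \<in> D}"

definition monotone_operator :: "('a::real_normed_vector \<Rightarrow> 'a dual) \<Rightarrow> bool" where
  "monotone_operator B \<longleftrightarrow> n_monotone 2 (\<lambda>x. {B x})"

definition coercive_op :: "('a::real_normed_vector \<Rightarrow>\<^sub>L 'a dual) \<Rightarrow> bool" where
  "coercive_op B \<longleftrightarrow> filterlim (\<lambda>x. blinfun_apply (blinfun_apply B x) x) at_top at_infinity"

definition dual_adjoint :: "('a::real_normed_vector \<Rightarrow>\<^sub>L 'a dual) \<Rightarrow> 'a \<Rightarrow> 'a dual" where
  "dual_adjoint B x = Blinfun (\<lambda>y. blinfun_apply (blinfun_apply B y) x)"

lemma dual_adjoint_apply [simp]:
  "blinfun_apply (dual_adjoint B x) y = blinfun_apply (blinfun_apply B y) x"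
proof -
  have "bounded_linear (\<lambda>y. blinfun_apply (blinfun_apply B y) x)"
    by (intro bounded_linear_intros)
  then show ?thesis
    by (simp add: dual_adjoint_def bounded_linear_Blinfun_apply)
qed

lemma monotone_operator_blinfun_iff:
  fixes B :: "'a::real_normed_vector \<Rightarrow>\<^sub>L 'a dual"
  shows "monotone_operator (blinfun_apply B) \<longleftrightarrow> (\<forall>x. 0 \<le> blinfun_apply (blinfun_apply B x) x)"
proof
  assume m: "monotone_operator (blinfun_apply B)"
  show "\<forall>x. 0 \<le> blinfun_apply (blinfun_apply B x) x"
  proof
    fix x :: 'a
    let ?s = "\<lambda>i::nat. if i = 2 then x else 0"
    have "(\<Sum>i = 1..2. blinfun_apply (blinfun_apply B (?s i)) (?s (i + 1) - ?s i)) \<le> 0"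
      using m[unfolded monotone_operator_def n_monotone_def n_monotone_set_def op_graph_def, rule_format,
          of ?s "\<lambda>i. blinfun_apply B (?s i)"] by simp
    then show "0 \<le> blinfun_apply (blinfun_apply B x) x"
      by (simp add: numeral_2_eq_2 blinfun.bilinear_simps)
  qed
next
  assume p: "\<forall>x. 0 \<le> blinfun_apply (blinfun_apply B x) x"
  show "monotone_operator (blinfun_apply B)"
    unfolding monotone_operator_def n_monotone_def n_monotone_set_def
  proof (intro allI impI, elim conjE)
    fix s :: "nat \<Rightarrow> 'a" and s' :: "nat \<Rightarrow> 'a dual"
    assume g: "\<forall>i\<in>{1..2}. (s i, s' i) \<in> op_graph (\<lambda>x. {blinfun_apply B x})"
      and c: "s (2 + 1) = s 1"
    have e: "s' 1 = blinfun_apply B (s 1)" "s' 2 = blinfun_apply B (s 2)"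
      using g by (auto simp: op_graph_def)
    have "0 \<le> blinfun_apply (blinfun_apply B (s 2 - s 1)) (s 2 - s 1)"
      using p by blast
    moreover have "(\<Sum>i = 1..2. blinfun_apply (s' i) (s (i + 1) - s i)) =
        blinfun_apply (s' 1) (s 2 - s 1) + blinfun_apply (s' 2) (s 1 - s 2)"
      using c by (simp add: numeral_2_eq_2)
    ultimately show "(\<Sum>i = 1..2. blinfun_apply (s' i) (s (i + 1) - s i)) \<le> 0"
      by (simp add: e[simplified] blinfun.bilinear_simps)
  qed
qed

end

theory Submission
  imports Defs
begin

text \<open>The set \<open>{(x, x')} \<union> G(S)\<close> is \<open>n\<close>-monotone iff \<open>F\<^bsub>S,n\<^esub>(x, x') \<le> \<langle>x', x\<rangle>\<close>, since a cycle through the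
  new point splits into loops at that point. Now \<open>F\<^bsub>S,n\<^esub>\<close> is a supremum of affine functions
  \<open>(x, x') \<mapsto> c + \<langle>p', x\<rangle> + \<langle>x', p\<rangle>\<close> with \<open>p \<in> D(S)\<close>. So one wants \<open>x\<close> in \<open>C = cl co D(S)\<close> such that
  \<open>g (c, p', p) x = c + \<langle>p', x\<rangle> + \<langle>w - Bx, p - x\<rangle> \<le> 0\<close> for all these \<open>(c, p', p)\<close>, or equivalently for all
  points of their convex hull. A coercive \<open>B\<close> satisfies \<open>\<langle>Bx, x\<rangle> \<ge> \<gamma> \<parallel>x\<parallel>\<^sup>2\<close> with \<open>\<gamma> > 0\<close>, so \<open>g z\<close> is strongly
  convex, and \<open>g\<close> is affine in \<open>z\<close>. By minimax it is enough to find, for each \<open>(c, p', p)\<close> of the hull, a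
  point of \<open>C\<close> where \<open>g (c, p', p) \<le> 0\<close>. The point \<open>p\<close> does it: \<open>g (c, p', p) p = c + \<langle>p', p\<rangle>\<close>, while
  \<open>\<langle>p', p\<rangle> \<le> F\<^bsub>S,n\<^esub>\<^sup>*(p', p) \<le> -c\<close> by hypothesis.\<close>

section \<open>A minimax theorem for strongly convex functions\<close>

lemma Cauchy_if_norm_diff_square_le:
  fixes x :: "nat \<Rightarrow> 'a::real_normed_vector" and e :: "nat \<Rightarrow> real"
  assumes e: "e \<longlonglongrightarrow> 0" and le: "\<And>i j. (norm (x i - x j))\<^sup>2 \<le> e i + e j"
  shows "Cauchy x"
proof (rule CauchyI)
  fix r :: real assume r: "0 < r"
  then have "0 < r\<^sup>2 / 2" by simp
  with e have "\<forall>\<^sub>F k in sequentially. e k < r\<^sup>2 / 2"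
    by (rule order_tendstoD(2))
  then obtain N where N: "\<And>k. k \<ge> N \<Longrightarrow> e k < r\<^sup>2 / 2"
    by (auto simp: eventually_sequentially)
  have "norm (x i - x j) < r" if "i \<ge> N" "j \<ge> N" for i j
  proof (rule power2_less_imp_less)
    show "(norm (x i - x j))\<^sup>2 < r\<^sup>2"
      using le[of i j] N[OF that(1)] N[OF that(2)] by linarith
  qed (use r in simp)
  then show "\<exists>N. \<forall>i\<ge>N. \<forall>j\<ge>N. norm (x i - x j) < r"
    by blast
qed

text \<open>The midpoint of two near-minimizers stays in \<open>C\<close> and cannot fall below the
  infimum, so \<open>mid\<close> forces them close together and a minimizing sequence is Cauchy.
  Applying \<open>mid\<close> to the minimizer and \<open>y\<close> then gives the quadratic
  growth.\<close>

lemma strongly_convex_attains_minimum: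
  fixes f :: "'a::banach \<Rightarrow> real"
  assumes C: "closed C" "convex C" "C \<noteq> {}"
    and cont: "continuous_on C f" and bdd: "bdd_below (f ` C)" and c: "c > 0"
    and mid: "\<And>x y. x \<in> C \<Longrightarrow> y \<in> C \<Longrightarrow>
      f ((1/2) *\<^sub>R x + (1/2) *\<^sub>R y) \<le> (f x + f y) / 2 - c * (norm (x - y))\<^sup>2"
  shows "\<exists>x\<in>C. \<forall>y\<in>C. f x + 2 * c * (norm (y - x))\<^sup>2 \<le> f y"
proof -
  define m where "m = Inf (f ` C)"
  have m_le: "m \<le> f x" if "x \<in> C" for x
    unfolding m_def using bdd that by (intro cInf_lower) auto
  have midC: "(1/2) *\<^sub>R x + (1/2) *\<^sub>R y \<in> C" if "x \<in> C" "y \<in> C" for x y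
    using convexD[OF C(2) that, of "1/2" "1/2"] by simp
  have "\<exists>x\<in>C. f x < m + 1 / (real k + 1)" for k :: nat
    using cInf_lessD[of "f ` C" "m + 1 / (real k + 1)"] C(3) by (auto simp: m_def)
  then obtain x where x: "\<And>k. x k \<in> C" "\<And>k. f (x k) < m + 1 / (real k + 1)"
    by metis
  have lim: "(\<lambda>k. 1 / (real k + 1)) \<longlonglongrightarrow> 0"
    using LIMSEQ_inverse_real_of_nat by (simp add: inverse_eq_divide add.commute)
  have "Cauchy x"
  proof (rule Cauchy_if_norm_diff_square_le)
    show "(\<lambda>k. 1 / (real k + 1) / (2 * c)) \<longlonglongrightarrow> 0"
      using tendsto_divide_zero[OF lim] by blast
    fix i j
    have "c * (norm (x i - x j))\<^sup>2 \<le> (1 / (real i + 1) + 1 / (real j + 1)) / 2"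
      using mid[OF x(1) x(1), of i j] m_le[OF midC[OF x(1) x(1)], of i j] x(2)[of i] x(2)[of j]
      by argo
    then have "(norm (x i - x j))\<^sup>2 \<le> (1 / (real i + 1) + 1 / (real j + 1)) / (2 * c)"
      using c by (simp add: pos_le_divide_eq ac_simps)
    then show "(norm (x i - x j))\<^sup>2 \<le> 1 / (real i + 1) / (2 * c) + 1 / (real j + 1) / (2 * c)"
      by (simp only: add_divide_distrib)
  qed
  then obtain a where a: "x \<longlonglongrightarrow> a"
    using Cauchy_convergent convergent_def by blast
  have aC: "a \<in> C"
    using closed_sequentially[OF C(1) _ a] x(1) by blast
  have "(\<lambda>k. f (x k)) \<longlonglongrightarrow> f a"
    using continuous_on_tendsto_compose[OF cont a aC] x(1) by simp
  moreover have "(\<lambda>k. m + 1 / (real k + 1)) \<longlonglongrightarrow> m"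
    using tendsto_add[OF tendsto_const lim, of m] by simp
  ultimately have "f a \<le> m"
    by (rule LIMSEQ_le) (use x(2) less_imp_le in blast)
  have "f a + 2 * c * (norm (y - a))\<^sup>2 \<le> f y" if "y \<in> C" for y
    using mid[OF that aC] m_le[OF midC[OF that aC]] \<open>f a \<le> m\<close> by argo
  with aC show ?thesis by blast
qed

text \<open>Writing \<open>\<xi> z\<close> for the minimizer of \<open>g z\<close>, strong convexity makes every sequence \<open>\<xi> (z k)\<close> with
  \<open>g (z k) (\<xi> (z k))\<close> tending to the supremum of the minima a Cauchy sequence. Its limit is the
  required point, as one sees by perturbing \<open>z k\<close> slightly towards a given \<open>z\<close>. No weak compactness
  is involved.\<close>

lemma strongly_convex_minimax:
  fixes g :: "'b::real_vector \<Rightarrow> 'a::banach \<Rightarrow> real"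
  assumes C: "closed C" "convex C" and M: "convex M" "M \<noteq> {}" and c: "c > 0"
    and cont: "\<And>z. z \<in> M \<Longrightarrow> continuous_on C (g z)"
    and bdd: "\<And>z. z \<in> M \<Longrightarrow> bdd_below (g z ` C)"
    and mid: "\<And>z x y. z \<in> M \<Longrightarrow> x \<in> C \<Longrightarrow> y \<in> C \<Longrightarrow>
      g z ((1/2) *\<^sub>R x + (1/2) *\<^sub>R y) \<le> (g z x + g z y) / 2 - c * (norm (x - y))\<^sup>2"
    and affine: "\<And>u z v x. u \<in> M \<Longrightarrow> z \<in> M \<Longrightarrow> x \<in> C \<Longrightarrow> 0 \<le> v \<Longrightarrow> v \<le> 1 \<Longrightarrow>
      g ((1 - v) *\<^sub>R u + v *\<^sub>R z) x = (1 - v) * g u x + v * g z x"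
    and nonpos: "\<And>z. z \<in> M \<Longrightarrow> \<exists>x\<in>C. g z x \<le> 0"
  shows "\<exists>x\<in>C. \<forall>z\<in>M. g z x \<le> 0"
proof -
  have "C \<noteq> {}" using M(2) nonpos by blast
  then have "\<forall>z\<in>M. \<exists>x\<in>C. \<forall>y\<in>C. g z x + 2 * c * (norm (y - x))\<^sup>2 \<le> g z y"
    by (intro ballI strongly_convex_attains_minimum[OF C _ cont bdd c mid])
  then obtain \<xi> where \<xi>C: "\<And>z. z \<in> M \<Longrightarrow> \<xi> z \<in> C"
    and growth: "\<And>z y. z \<in> M \<Longrightarrow> y \<in> C \<Longrightarrow> g z (\<xi> z) + 2 * c * (norm (y - \<xi> z))\<^sup>2 \<le> g z y"
    by metis
  define \<phi> where "\<phi> z = g z (\<xi> z)" for z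
  define b where "b = Sup (\<phi> ` M)"
  have \<phi>_nonpos: "\<phi> z \<le> 0" if "z \<in> M" for z
  proof -
    obtain x where "x \<in> C" "g z x \<le> 0" using nonpos[OF \<open>z \<in> M\<close>] by blast
    moreover have "0 \<le> 2 * c * (norm (x - \<xi> z))\<^sup>2" using c by simp
    ultimately show ?thesis
      using growth[OF that \<open>x \<in> C\<close>] unfolding \<phi>_def by linarith
  qed
  have b_nonpos: "b \<le> 0"
    unfolding b_def using M(2) \<phi>_nonpos by (intro cSup_least) auto
  have \<phi>_le: "\<phi> z \<le> b" if "z \<in> M" for z
    unfolding b_def using \<phi>_nonpos that by (intro cSup_upper) (auto intro!: bdd_aboveI)
  \<comment> \<open>Weights for perturbing \<open>z k\<close>. The shift by 2 keeps
    \<open>1 - d k\<close> at least 1/2, and errors of size \<open>(d k)\<^sup>2\<close> still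
    vanish after division by \<open>d k\<close>.\<close>
  define d where "d k = 1 / (real k + 2)" for k
  have d: "0 < d k" "d k \<le> 1/2" for k by (auto simp: d_def field_simps)
  have d_lim: "d \<longlonglongrightarrow> 0"
    using LIMSEQ_ignore_initial_segment[OF LIMSEQ_inverse_real_of_nat, of 1]
    by (simp add: d_def[abs_def] inverse_eq_divide add.commute)
  have "\<exists>z\<in>M. b - (d k)\<^sup>2 < \<phi> z" for k
    using less_cSupD[of "\<phi> ` M" "b - (d k)\<^sup>2"] M(2) d(1)[of k] by (auto simp: b_def)
  then obtain z where z: "\<And>k. z k \<in> M" "\<And>k. b - (d k)\<^sup>2 < \<phi> (z k)"
    by metis
  have d2_lim: "(\<lambda>k. (d k)\<^sup>2) \<longlonglongrightarrow> 0"
    using tendsto_power[OF d_lim, of 2] by simp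
  have "Cauchy (\<lambda>k. \<xi> (z k))"
  proof (rule Cauchy_if_norm_diff_square_le)
    show "(\<lambda>k. 1 / c * (d k)\<^sup>2) \<longlonglongrightarrow> 0"
      using tendsto_mult_right_zero[OF d2_lim] by blast
    fix i j
    \<comment> \<open>The minimizer at the midpoint of \<open>z i\<close> and \<open>z j\<close>
      serves as go-between: by growth, its distances to \<open>\<xi> (z i)\<close> and
      \<open>\<xi> (z j)\<close> are controlled by how far \<open>\<phi> (z i)\<close> and
      \<open>\<phi> (z j)\<close> fall short of \<open>b\<close>.\<close>
    let ?u = "(1 - 1/2) *\<^sub>R z i + (1/2) *\<^sub>R z j"
    have uM: "?u \<in> M" using convexD[OF M(1) z(1) z(1), of "1/2" "1/2" i j] by simp
    define y where "y = \<xi> ?u"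
    have yC: "y \<in> C" using \<xi>C[OF uM] by (simp add: y_def)
    have mean: "\<phi> ?u = g (z i) y / 2 + g (z j) y / 2"
      using affine[OF z(1) z(1) yC, of "1/2" i j] by (simp add: \<phi>_def y_def)
    then have 1: "(\<phi> (z i) + \<phi> (z j)) / 2 + c * ((norm (y - \<xi> (z i)))\<^sup>2 + (norm (y - \<xi> (z j)))\<^sup>2) \<le> b"
      using growth[OF z(1) yC, of i] growth[OF z(1) yC, of j] \<phi>_le[OF uM] mean
      unfolding \<phi>_def[of "z i"] \<phi>_def[of "z j"] distrib_left by argo
    have "(norm (\<xi> (z i) - \<xi> (z j)))\<^sup>2 \<le> (norm (y - \<xi> (z j)) + norm (y - \<xi> (z i)))\<^sup>2"
      using norm_triangle_ineq4[of "y - \<xi> (z j)" "y - \<xi> (z i)"] by (intro power_mono) auto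
    also have "\<dots> \<le> 2 * ((norm (y - \<xi> (z i)))\<^sup>2 + (norm (y - \<xi> (z j)))\<^sup>2)"
      using sum_squares_bound[of "norm (y - \<xi> (z j))" "norm (y - \<xi> (z i))"]
      by (simp add: power2_sum)
    finally have "c * (norm (\<xi> (z i) - \<xi> (z j)))\<^sup>2
        \<le> c * (2 * ((norm (y - \<xi> (z i)))\<^sup>2 + (norm (y - \<xi> (z j)))\<^sup>2))"
      using c by (intro mult_left_mono) auto
    then have "c * (norm (\<xi> (z i) - \<xi> (z j)))\<^sup>2 \<le> (d i)\<^sup>2 + (d j)\<^sup>2"
      using 1 z(2)[of i] z(2)[of j] by argo
    then show "(norm (\<xi> (z i) - \<xi> (z j)))\<^sup>2 \<le> 1 / c * (d i)\<^sup>2 + 1 / c * (d j)\<^sup>2"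
      using c by (simp add: field_simps)
  qed
  then obtain a where a: "(\<lambda>k. \<xi> (z k)) \<longlonglongrightarrow> a"
    using Cauchy_convergent convergent_def by blast
  have aC: "a \<in> C"
    using closed_sequentially[OF C(1) _ a] \<xi>C z(1) by blast
  have "g u a \<le> 0" if u: "u \<in> M" for u
  proof -
    \<comment> \<open>Minimizers after moving \<open>z k\<close> slightly towards \<open>u\<close>.
      That no minimum exceeds \<open>b\<close> bounds \<open>g u (y k)\<close> from above by
      \<open>d k\<close>; growth keeps \<open>y k\<close> near \<open>\<xi> (z k)\<close>, so
      \<open>y\<close> also tends to \<open>a\<close>.\<close>
    define y where "y k = \<xi> ((1 - d k) *\<^sub>R z k + d k *\<^sub>R u)" for k
    have zuM: "(1 - d k) *\<^sub>R z k + d k *\<^sub>R u \<in> M" for k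
      using convexD[OF M(1) z(1) u] d[of k] by (smt (verit) field_sum_of_halves)
    have yC: "y k \<in> C" for k using \<xi>C[OF zuM] by (simp add: y_def)
    have key: "(1 - d k) * (\<phi> (z k) + 2 * c * (norm (y k - \<xi> (z k)))\<^sup>2) + d k * g u (y k) \<le> b" for k
    proof -
      have "(1 - d k) * g (z k) (y k) + d k * g u (y k) \<le> b"
        using \<phi>_le[OF zuM, of k] affine[OF z(1) u yC, of "d k" k k] d[of k] by (simp add: \<phi>_def y_def)
      moreover have "(1 - d k) * (\<phi> (z k) + 2 * c * (norm (y k - \<xi> (z k)))\<^sup>2) \<le> (1 - d k) * g (z k) (y k)"
        using growth[OF z(1) yC, of k k] d[of k] unfolding \<phi>_def by (intro mult_left_mono) auto
      ultimately show ?thesis by linarith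
    qed
    have low: "b - d k * b - (d k)\<^sup>2 \<le> (1 - d k) * \<phi> (z k)" for k
    proof -
      have "(1 - d k) * (b - (d k)\<^sup>2) \<le> (1 - d k) * \<phi> (z k)"
        using z(2)[of k] d[of k] by (intro mult_left_mono) auto
      moreover have "0 \<le> d k * (d k)\<^sup>2" using d[of k] by simp
      ultimately show ?thesis by (simp add: algebra_simps)
    qed
    have upper: "g u (y k) \<le> d k" for k
    proof -
      have "0 \<le> (1 - d k) * (2 * c * (norm (y k - \<xi> (z k)))\<^sup>2)" using c d[of k] by simp
      then have "d k * g u (y k) \<le> d k * b + (d k)\<^sup>2"
        using key[of k] low[of k] unfolding distrib_left by linarith
      also have "\<dots> \<le> d k * d k"
        using b_nonpos d(1)[of k] by (simp add: power2_eq_square mult_nonneg_nonpos)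
      finally show ?thesis using d(1)[of k] by simp
    qed
    have near: "(norm (y k - \<xi> (z k)))\<^sup>2 \<le> 1 / c * ((d k)\<^sup>2 - d k * \<phi> u)" for k
    proof -
      \<comment> \<open>The minimum \<open>\<phi> u\<close> is a lower bound independent of
        \<open>k\<close>, so its contribution vanishes with \<open>d k\<close>.\<close>
      have "\<phi> u \<le> g u (y k)"
        using growth[OF u yC, of k] c unfolding \<phi>_def by (smt (verit) mult_nonneg_nonneg zero_le_power2)
      then have "d k * \<phi> u \<le> d k * g u (y k)" using d(1)[of k] by (intro mult_left_mono) auto
      moreover have "d k * b \<le> 0" using b_nonpos d(1)[of k] by (simp add: mult_nonneg_nonpos)
      moreover have "(1/2) * (2 * c * (norm (y k - \<xi> (z k)))\<^sup>2) \<le> (1 - d k) * (2 * c * (norm (y k - \<xi> (z k)))\<^sup>2)"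
        using c d(2)[of k] by (intro mult_right_mono) auto
      ultimately have "c * (norm (y k - \<xi> (z k)))\<^sup>2 \<le> (d k)\<^sup>2 - d k * \<phi> u"
        using key[of k] low[of k] unfolding distrib_left by linarith
      then show ?thesis using c by (simp add: field_simps)
    qed
    have "(\<lambda>k. 1 / c * ((d k)\<^sup>2 - d k * \<phi> u)) \<longlonglongrightarrow> 1 / c * (0 - 0 * \<phi> u)"
      by (intro tendsto_intros d_lim d2_lim)
    then have bound_lim: "(\<lambda>k. 1 / c * ((d k)\<^sup>2 - d k * \<phi> u)) \<longlonglongrightarrow> 0" by simp
    have "(\<lambda>k. (norm (y k - \<xi> (z k)))\<^sup>2) \<longlonglongrightarrow> 0"
      by (rule tendsto_sandwich[OF _ _ tendsto_const bound_lim]) (intro always_eventually allI near zero_le_power2)+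
    then have "(\<lambda>k. sqrt ((norm (y k - \<xi> (z k)))\<^sup>2)) \<longlonglongrightarrow> sqrt 0"
      by (rule tendsto_real_sqrt)
    then have "(\<lambda>k. y k - \<xi> (z k)) \<longlonglongrightarrow> 0"
      by (simp add: tendsto_norm_zero_iff)
    from tendsto_add[OF this a] have "y \<longlonglongrightarrow> a" by simp
    from continuous_on_tendsto_compose[OF cont[OF u] this aC]
    have "(\<lambda>k. g u (y k)) \<longlonglongrightarrow> g u a" using yC by simp
    from LIMSEQ_le[OF this d_lim] upper show ?thesis by blast
  qed
  with aC show ?thesis by blast
qed

section \<open>Coercive operators\<close>

text \<open>The form is homogeneous of degree two: once it is at least 1 outside the ball of radius
  \<open>r\<close>, rescaling \<open>x\<close> to norm \<open>r\<close> yields the constant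
  \<open>1 / r\<^sup>2\<close>.\<close>

lemma coercive_op_lower_bound:
  fixes B :: "'a::real_normed_vector \<Rightarrow>\<^sub>L 'a dual"
  assumes "coercive_op B"
  obtains c where "c > 0" "\<And>x. c * (norm x)\<^sup>2 \<le> blinfun_apply (blinfun_apply B x) x"
proof -
  have "\<forall>\<^sub>F x in at_infinity. 1 \<le> blinfun_apply (blinfun_apply B x) x"
    using assms unfolding coercive_op_def filterlim_at_top by blast
  then obtain r where r: "r > 0" "\<And>x. r \<le> norm x \<Longrightarrow> 1 \<le> blinfun_apply (blinfun_apply B x) x"
    unfolding eventually_at_infinity_pos by blast
  show thesis
  proof
    show "1 / r\<^sup>2 > 0" using r(1) by simp
    show "1 / r\<^sup>2 * (norm x)\<^sup>2 \<le> blinfun_apply (blinfun_apply B x) x" for x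
    proof (cases "x = 0")
      case False
      let ?t = "r / norm x"
      have "1 \<le> blinfun_apply (blinfun_apply B (?t *\<^sub>R x)) (?t *\<^sub>R x)"
        using r(1) False by (intro r(2)) simp
      also have "\<dots> = ?t\<^sup>2 * blinfun_apply (blinfun_apply B x) x"
        by (simp add: blinfun.bilinear_simps power2_eq_square)
      finally show ?thesis
        using r(1) False by (simp add: field_simps)
    qed simp
  qed
qed

text \<open>A parallelogram identity for a possibly nonsymmetric \<open>B\<close>; it turns the
  quadratic lower bound into strong convexity.\<close>

lemma quadratic_form_midpoint:
  fixes B :: "'a::real_normed_vector \<Rightarrow>\<^sub>L 'a dual"
  defines "q \<equiv> \<lambda>x. blinfun_apply (blinfun_apply B x) x"
  shows "q ((1/2) *\<^sub>R x + (1/2) *\<^sub>R y) = (q x + q y) / 2 - q (x - y) / 4"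
  unfolding q_def by (simp add: blinfun.bilinear_simps field_simps)

section \<open>Adjoining a point to an n-monotone set\<close>

text \<open>Repeating the last point pads a chain of length \<open>m\<close> to length
  \<open>n - 1\<close>, and the added steps contribute zero.\<close>

lemma chain_extend:
  fixes G :: "('a::real_normed_vector \<times> 'a dual) set" and n :: nat
  assumes chain: "\<And>s s'. \<forall>i\<in>{1..n - 1}. (s i, s' i) \<in> G \<Longrightarrow>
      (\<Sum>i = 1..n - 2. blinfun_apply (s' i) (s (i + 1) - s i))
        + blinfun_apply (s' (n - 1)) (x - s (n - 1)) + blinfun_apply x' (s 1 - x) \<le> 0"
    and m: "1 \<le> m" "m \<le> n - 1" and G: "\<And>i. i \<in> {1..m} \<Longrightarrow> (t i, t' i) \<in> G"
  shows "(\<Sum>i = 1..<m. blinfun_apply (t' i) (t (i + 1) - t i))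
        + blinfun_apply (t' m) (x - t m) + blinfun_apply x' (t 1 - x) \<le> 0"
proof -
  let ?s = "\<lambda>i. t (min i m)" and ?s' = "\<lambda>i. t' (min i m)"
  have in_G: "\<forall>i\<in>{1..n - 1}. (?s i, ?s' i) \<in> G"
    using m by (auto intro!: G)
  have ends: "min (n - 1) m = m" "min 1 m = 1" using m by auto
  have "(\<Sum>i = 1..n - 2. blinfun_apply (?s' i) (?s (i + 1) - ?s i))
      = (\<Sum>i = 1..<m. blinfun_apply (?s' i) (?s (i + 1) - ?s i))"
    using m by (intro sum.mono_neutral_right) (auto simp: min_def)
  also have "\<dots> = (\<Sum>i = 1..<m. blinfun_apply (t' i) (t (i + 1) - t i))"
    by (intro sum.cong) (auto simp: min_def)
  finally show ?thesis
    using chain[OF in_G] unfolding ends by simp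
qed

text \<open>Strong induction on the length: an interior visit to \<open>(x, x')\<close> cuts the
  loop into two shorter ones; without such a visit the interior is a chain in \<open>G\<close>,
  covered by \<open>chain_extend\<close>.\<close>

lemma closed_path_le_zero:
  fixes G :: "('a::real_normed_vector \<times> 'a dual) set" and n :: nat
  assumes chain: "\<And>s s'. \<forall>i\<in>{1..n - 1}. (s i, s' i) \<in> G \<Longrightarrow>
      (\<Sum>i = 1..n - 2. blinfun_apply (s' i) (s (i + 1) - s i))
        + blinfun_apply (s' (n - 1)) (x - s (n - 1)) + blinfun_apply x' (s 1 - x) \<le> 0"
    and "m \<le> n" "\<And>i. i < m \<Longrightarrow> (t i, t' i) \<in> insert (x, x') G"
    and "m > 0 \<Longrightarrow> (t 0, t' 0) = (x, x')" "t m = x"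
  shows "(\<Sum>i<m. blinfun_apply (t' i) (t (i + 1) - t i)) \<le> 0"
  using assms(2-)
proof (induction m arbitrary: t t' rule: less_induct)
  case (less m)
  show ?case
  proof (cases "\<exists>j. 0 < j \<and> j < m \<and> (t j, t' j) = (x, x')")
    case True
    then obtain j where j: "0 < j" "j < m" "t j = x" "t' j = x'" by auto
    have "sum f {..<j + k} = sum f {..<j} + (\<Sum>i<k. f (i + j))" for f :: "nat \<Rightarrow> real" and k
      by (induction k) (simp_all add: add_ac)
    from this[of _ "m - j"] have "(\<Sum>i<m. blinfun_apply (t' i) (t (i + 1) - t i))
        = (\<Sum>i<j. blinfun_apply (t' i) (t (i + 1) - t i))
        + (\<Sum>i<m - j. blinfun_apply (t' (i + j)) (t (i + 1 + j) - t (i + j)))"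
      using j by simp
    moreover have "(\<Sum>i<j. blinfun_apply (t' i) (t (i + 1) - t i)) \<le> 0"
      using less.prems j by (intro less.IH) auto
    moreover have "(\<Sum>i<m - j. blinfun_apply (t' (i + j)) (t (i + 1 + j) - t (i + j))) \<le> 0"
      using less.prems j by (intro less.IH) auto
    ultimately show ?thesis by simp
  next
    case False
    then have G: "(t i, t' i) \<in> G" if "0 < i" "i < m" for i
      using less.prems(2)[OF that(2)] that by auto
    consider "m = 0" | "m = 1" | "m \<ge> 2" by linarith
    then show ?thesis
    proof cases
      case 3
      define k where "k = m - 1"
      then have k: "m = Suc k" "k \<ge> 1" "k \<le> n - 1" using 3 less.prems(1) by auto
      have "(\<Sum>i<m. blinfun_apply (t' i) (t (i + 1) - t i))
          = blinfun_apply x' (t 1 - x) + (\<Sum>i = 1..<k. blinfun_apply (t' i) (t (i + 1) - t i))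
            + blinfun_apply (t' k) (x - t k)"
        using k less.prems(3,4)
        by (simp add: lessThan_atLeast0 sum.atLeast_Suc_lessThan)
      also have "\<dots> \<le> 0"
        using chain_extend[where G = G and m = k and t = t and t' = t', OF chain k(2,3) G] k(1)
        by simp
      finally show ?thesis .
    qed (use less.prems in auto)
  qed
qed

text \<open>A cycle avoiding the new pair is handled by monotonicity of \<open>G\<close>; any other
  is rotated into a closed path starting at that pair.\<close>

lemma n_monotone_set_insertI:
  fixes G :: "('a::real_normed_vector \<times> 'a dual) set" and n :: nat
  assumes G: "n_monotone_set n G"
    and chain: "\<And>s s'. \<forall>i\<in>{1..n - 1}. (s i, s' i) \<in> G \<Longrightarrow>
      (\<Sum>i = 1..n - 2. blinfun_apply (s' i) (s (i + 1) - s i))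
        + blinfun_apply (s' (n - 1)) (x - s (n - 1)) + blinfun_apply x' (s 1 - x) \<le> 0"
  shows "n_monotone_set n (insert (x, x') G)"
  unfolding n_monotone_set_def
proof (intro allI impI, elim conjE)
  fix s :: "nat \<Rightarrow> 'a" and s' :: "nat \<Rightarrow> 'a dual"
  assume in_G: "\<forall>i\<in>{1..n}. (s i, s' i) \<in> insert (x, x') G" and cyc: "s (n + 1) = s 1"
  show "(\<Sum>i = 1..n. blinfun_apply (s' i) (s (i + 1) - s i)) \<le> 0"
  proof (cases "\<exists>j\<in>{1..n}. (s j, s' j) = (x, x')")
    case False
    then have "\<forall>i\<in>{1..n}. (s i, s' i) \<in> G" using in_G by fastforce
    then show ?thesis using G cyc unfolding n_monotone_set_def by blast
  next
    case True
    then obtain j where j: "j < n" "s (Suc j) = x" "s' (Suc j) = x'"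
      by (metis Pair_inject Suc_le_D Suc_le_lessD atLeastAtMost_iff One_nat_def)
    \<comment> \<open>Rotation bringing the new pair to index 0; \<open>Suc\<close> translates
      residues modulo \<open>n\<close> into the indices from 1 to \<open>n\<close>. The inverse
      rotates by \<open>n - j\<close>.\<close>
    define t where "t i = s (Suc ((i + j) mod n))" for i
    define t' where "t' i = s' (Suc ((i + j) mod n))" for i
    have step: "s (Suc (Suc k)) = s (Suc (Suc k mod n))" if "k < n" for k
      using that cyc by (cases "Suc k = n") auto
    have "(\<Sum>i = 1..n. blinfun_apply (s' i) (s (i + 1) - s i))
        = (\<Sum>i<n. blinfun_apply (s' (Suc i)) (s (Suc (Suc i mod n)) - s (Suc i)))"
      by (simp add: sum.atLeast1_atMost_eq step)
    also have "\<dots> = (\<Sum>i<n. blinfun_apply (t' i) (t (i + 1) - t i))"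
    proof (rule sym, rule sum.reindex_bij_witness[where j = "\<lambda>i. (i + j) mod n" and i = "\<lambda>i. (i + (n - j)) mod n"])
      show "((a + j) mod n + (n - j)) mod n = a" if "a \<in> {..<n}" for a
        using that j(1) mod_add_left_eq[of "a + j" n "n - j"] by simp
      show "((b + (n - j)) mod n + j) mod n = b" if "b \<in> {..<n}" for b
        using that j(1) mod_add_left_eq[of "b + (n - j)" n j] by simp
    qed (use j(1) in \<open>auto simp: t_def t'_def mod_simps\<close>)
    also have "\<dots> \<le> 0"
      using in_G j by (intro closed_path_le_zero[OF chain, where m = n])
        (auto simp: t_def t'_def Suc_le_eq)
    finally show ?thesis .
  qed
qed

section \<open>The affine minorants of the Fitzpatrick function\<close>

text \<open>The slopes are the last functional and the first point of a chain. Coefficient triples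
  form a vector space, so \<open>convex hull\<close> can mix the affine functions.\<close>

definition fitzpatrick_minorants ::
    "('a::real_normed_vector \<Rightarrow> 'a dual set) \<Rightarrow> nat \<Rightarrow> (real \<times> 'a dual \<times> 'a) set" where
  "fitzpatrick_minorants S n =
     {((\<Sum>i = 1..n - 2. blinfun_apply (s' i) (s (i + 1) - s i)) - blinfun_apply (s' (n - 1)) (s (n - 1)),
       s' (n - 1), s 1) | s s'. \<forall>i\<in>{1..n - 1}. (s i, s' i) \<in> op_graph S}"

text \<open>At a fixed argument the value \<open>h\<close> is linear in the triple, so the triples
  satisfying the bound form a convex set containing the generators.\<close>

lemma fitzpatrick_minorants_hull_le:
  assumes "(c, p', p) \<in> convex hull fitzpatrick_minorants S n"
  shows "ereal (c + blinfun_apply p' y + blinfun_apply y' p) \<le> fitzpatrick S n (y, y')"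
proof -
  define h :: "real \<times> 'a dual \<times> 'a \<Rightarrow> real" where
    "h = (\<lambda>(c, p', p). c + blinfun_apply p' y + blinfun_apply y' p)"
  have h: "h (u *\<^sub>R v + r *\<^sub>R z) = u * h v + r * h z" for u r v z
    by (cases v; cases z) (simp add: h_def blinfun.bilinear_simps algebra_simps)
  have "fitzpatrick_minorants S n \<subseteq> {z. ereal (h z) \<le> fitzpatrick S n (y, y')}"
  proof
    fix z assume "z \<in> fitzpatrick_minorants S n"
    then obtain s s' where s: "\<forall>i\<in>{1..n - 1}. (s i, s' i) \<in> op_graph S"
      and z: "z = ((\<Sum>i = 1..n - 2. blinfun_apply (s' i) (s (i + 1) - s i))
        - blinfun_apply (s' (n - 1)) (s (n - 1)), s' (n - 1), s 1)"
      unfolding fitzpatrick_minorants_def by blast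
    have "h z = (\<Sum>i = 1..n - 2. blinfun_apply (s' i) (s (i + 1) - s i))
        + blinfun_apply (s' (n - 1)) (y - s (n - 1)) + blinfun_apply y' (s 1)"
      unfolding z h_def by (simp add: blinfun.diff_right)
    with s show "z \<in> {z. ereal (h z) \<le> fitzpatrick S n (y, y')}"
      unfolding fitzpatrick_def by (auto intro!: Sup_upper)
  qed
  moreover have "convex {z. ereal (h z) \<le> fitzpatrick S n (y, y')}"
  proof (rule convexI)
    fix v z and u r :: real
    assume *: "v \<in> {z. ereal (h z) \<le> fitzpatrick S n (y, y')}"
      "z \<in> {z. ereal (h z) \<le> fitzpatrick S n (y, y')}" and ur: "0 \<le> u" "0 \<le> r" "u + r = 1"
    \<comment> \<open>Bounding by the maximum avoids arithmetic with infinite values of the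
      Fitzpatrick function.\<close>
    have "h (u *\<^sub>R v + r *\<^sub>R z) \<le> max (h v) (h z)"
      unfolding h using ur by (intro convex_bound_le) auto
    then have "ereal (h (u *\<^sub>R v + r *\<^sub>R z)) \<le> max (ereal (h v)) (ereal (h z))"
      by (simp add: max_def split: if_splits)
    then show "u *\<^sub>R v + r *\<^sub>R z \<in> {z. ereal (h z) \<le> fitzpatrick S n (y, y')}"
      using * by (auto intro: order_trans)
  qed
  ultimately have "convex hull fitzpatrick_minorants S n \<subseteq> {z. ereal (h z) \<le> fitzpatrick S n (y, y')}"
    by (rule hull_minimal)
  with assms show ?thesis by (auto simp: h_def)
qed

text \<open>Conjugation reverses order, and an affine function with constant term \<open>c\<close>
  has conjugate \<open>- c\<close> at its own slope.\<close>

lemma fenchel_conjugate_fitzpatrick_le: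
  assumes "(c, p', p) \<in> convex hull fitzpatrick_minorants S n"
  shows "fenchel_conjugate (fitzpatrick S n) (p', p) \<le> ereal (- c)"
  unfolding fenchel_conjugate_def prod.case
proof (rule SUP_least, clarify)
  fix y y'
  have "ereal (blinfun_apply p' y + blinfun_apply y' p) - fitzpatrick S n (y, y')
      \<le> ereal (blinfun_apply p' y + blinfun_apply y' p)
        - ereal (c + blinfun_apply p' y + blinfun_apply y' p)"
    by (intro ereal_minus_mono order_refl fitzpatrick_minorants_hull_le[OF assms])
  then show "ereal (blinfun_apply p' y + blinfun_apply y' p) - fitzpatrick S n (y, y') \<le> ereal (- c)"
    by simp
qed

text \<open>The last component is linear in the triple, and \<open>n \<ge> 2\<close> makes
  \<open>s 1\<close> a point of the chain, hence of the domain.\<close>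

lemma fitzpatrick_minorants_hull_domain:
  assumes "n \<ge> 2" and "(c, p', p) \<in> convex hull fitzpatrick_minorants S n"
  shows "p \<in> convex hull op_domain S"
proof -
  have "fitzpatrick_minorants S n \<subseteq> {z. snd (snd z) \<in> convex hull op_domain S}"
    using assms(1)
    by (force simp: fitzpatrick_minorants_def op_domain_def op_graph_def intro!: hull_inc)
  moreover have "convex {z :: real \<times> 'a dual \<times> 'a. snd (snd z) \<in> convex hull op_domain S}"
    by (rule convexI) (simp add: convexD[OF convex_convex_hull])
  ultimately have "convex hull fitzpatrick_minorants S n \<subseteq> {z. snd (snd z) \<in> convex hull op_domain S}"
    by (rule hull_minimal)
  with assms show ?thesis by auto
qed

section \<open>Minimax applied to the hull of the affine minorants\<close>

theorem theorem5:
  fixes S :: "'a::banach \<Rightarrow> 'a dual set"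
    and B :: "'a \<Rightarrow>\<^sub>L 'a dual"
    and n :: nat
  assumes "reflexive_space TYPE('a)"
    and "n \<ge> 2"
    and "n_monotone n S"
    and "op_graph S \<noteq> {}"
    and "\<forall>(x' :: 'a dual) (x :: 'a).
           ereal (blinfun_apply x' x) \<le> fenchel_conjugate (fitzpatrick S n) (x', x)"
    and "monotone_operator (blinfun_apply B)"
    and "coercive_op B"
  shows "\<forall>w :: 'a dual.
           (0, w) \<in> minkowski_diff
              (effective_domain (transpose_fun (fenchel_conjugate (fitzpatrick S n))))
              (op_graph (\<lambda>x. {dual_adjoint B x})) \<longrightarrow>
           (\<exists>x \<in> closure (convex hull (op_domain S)).
              n_monotone_set n ({(x, w - blinfun_apply B x)} \<union> op_graph S))"
proof (intro allI impI)
  fix w :: "'a dual"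
  define C where "C = closure (convex hull (op_domain S))"
  define M where "M = convex hull fitzpatrick_minorants S n"
  define g :: "real \<times> 'a dual \<times> 'a \<Rightarrow> 'a \<Rightarrow> real" where
    "g = (\<lambda>(c, p', p) x. c + blinfun_apply p' x + blinfun_apply (w - blinfun_apply B x) (p - x))"
  obtain \<gamma> where \<gamma>: "\<gamma> > 0" "\<And>x. \<gamma> * (norm x)\<^sup>2 \<le> blinfun_apply (blinfun_apply B x) x"
    using coercive_op_lower_bound[OF assms(7)] by blast
  have "\<exists>x\<in>C. \<forall>z\<in>M. g z x \<le> 0"
  \<comment> \<open>The constant combines the lower bound \<open>\<gamma>\<close> with the factor
    1/4 of \<open>quadratic_form_midpoint\<close>.\<close>
  proof (rule strongly_convex_minimax[where c = "\<gamma> / 4"])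
    show "closed C" "convex C" by (auto simp: C_def convex_closure)
    obtain s0 s0' where "(s0, s0') \<in> op_graph S" using assms(4) by auto
    then have "\<forall>i\<in>{1..n - 1}. ((\<lambda>_. s0) i, (\<lambda>_. s0') i) \<in> op_graph S" by blast
    then show "convex M" "M \<noteq> {}" unfolding M_def fitzpatrick_minorants_def by fastforce+
    show "\<gamma> / 4 > 0" using \<gamma>(1) by simp
    fix z assume z: "z \<in> M"
    obtain c p' p where zeq: "z = (c, p', p)" by (cases z)
    show "continuous_on C (g z)"
      unfolding g_def zeq prod.case by (intro continuous_intros)
    \<comment> \<open>Rewriting \<open>\<langle>Bx, p\<rangle>\<close> by the adjoint splits
      \<open>g z\<close> into a constant, a linear term and the quadratic form.\<close>
    have gz: "g z x = (c + blinfun_apply w p) + blinfun_apply (p' - w - dual_adjoint B p) x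
        + blinfun_apply (blinfun_apply B x) x" for x
      by (simp add: g_def zeq blinfun.bilinear_simps)
    show "bdd_below (g z ` C)"
    proof (rule bdd_belowI2)
      fix x
      define L where "L = norm (p' - w - dual_adjoint B p)"
      have "- (L * norm x) \<le> blinfun_apply (p' - w - dual_adjoint B p) x"
        using norm_blinfun[of "p' - w - dual_adjoint B p" x] unfolding L_def by (simp add: abs_le_iff)
      \<comment> \<open>Completing the square in \<open>norm x\<close>.\<close>
      moreover have "- (L\<^sup>2 / (4 * \<gamma>)) \<le> \<gamma> * (norm x)\<^sup>2 - L * norm x"
      proof -
        have "0 \<le> (2 * \<gamma> * norm x - L)\<^sup>2 / (4 * \<gamma>)" using \<gamma>(1) by simp
        then show ?thesis using \<gamma>(1) by (simp add: field_simps power2_eq_square)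
      qed
      ultimately show "c + blinfun_apply w p - L\<^sup>2 / (4 * \<gamma>) \<le> g z x"
        using \<gamma>(2)[of x] unfolding gz by linarith
    qed
    show "g z ((1/2) *\<^sub>R x + (1/2) *\<^sub>R y) \<le> (g z x + g z y) / 2 - \<gamma> / 4 * (norm (x - y))\<^sup>2" for x y
      using \<gamma>(2)[of "x - y"]
      unfolding gz quadratic_form_midpoint
        blinfun.add_right[of "p' - w - dual_adjoint B p"] blinfun.scaleR_right[of "p' - w - dual_adjoint B p"]
      by (simp only: real_scaleR_def) argo
    show "\<exists>x\<in>C. g z x \<le> 0"
    proof
      show "p \<in> C"
        using fitzpatrick_minorants_hull_domain[OF assms(2) z[unfolded M_def zeq]] closure_subset
        unfolding C_def by blast
      have "ereal (blinfun_apply p' p) \<le> ereal (- c)"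
        using fenchel_conjugate_fitzpatrick_le[OF z[unfolded M_def zeq]] assms(5) order_trans by blast
      then show "g z p \<le> 0" by (simp add: g_def zeq)
    qed
    show "g ((1 - v) *\<^sub>R z + v *\<^sub>R u) x = (1 - v) * g z x + v * g u x" for v u x
      by (cases u) (simp add: g_def zeq blinfun.bilinear_simps algebra_simps)
  qed
  then obtain x where x: "x \<in> C" "\<And>z. z \<in> M \<Longrightarrow> g z x \<le> 0" by blast
  have "n_monotone_set n (insert (x, w - blinfun_apply B x) (op_graph S))"
  proof (rule n_monotone_set_insertI)
    show "n_monotone_set n (op_graph S)" using assms(3) by (simp add: n_monotone_def)
    fix s :: "nat \<Rightarrow> 'a" and s' :: "nat \<Rightarrow> 'a dual"
    assume "\<forall>i\<in>{1..n - 1}. (s i, s' i) \<in> op_graph S"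
    then have "((\<Sum>i = 1..n - 2. blinfun_apply (s' i) (s (i + 1) - s i))
        - blinfun_apply (s' (n - 1)) (s (n - 1)), s' (n - 1), s 1) \<in> M"
      unfolding M_def fitzpatrick_minorants_def by (intro hull_inc) blast
    \<comment> \<open>At a generator of the hull, \<open>g\<close> is the left-hand side of the
      chain inequality for the new pair.\<close>
    from x(2)[OF this]
    show "(\<Sum>i = 1..n - 2. blinfun_apply (s' i) (s (i + 1) - s i))
        + blinfun_apply (s' (n - 1)) (x - s (n - 1)) + blinfun_apply (w - blinfun_apply B x) (s 1 - x) \<le> 0"
      by (simp add: g_def blinfun.diff_right)
  qed
  with x(1) show "\<exists>x \<in> closure (convex hull (op_domain S)).
      n_monotone_set n ({(x, w - blinfun_apply B x)} \<union> op_graph S)"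
    unfolding C_def by auto
qed

end
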